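(* Let $c\in(0,1]$ be a constant and let $\sigma,N\ge2$ be integers. Call an integer $m\ge2$ admissible if, for $\ell:=\lfloor c\log_\sigma m\rfloor$, it holds $\ell\ge1$ and $m\ell\le N$, and assume that an admissible $m$ exists. Any data structure supporting prefix select queries with ranks in $\{1,\dots,m\}$ for every admissible $m$ and every sequence $W[1..m]$ of $m$ strings over alphabet $[0..\sigma)$, each of length exactly $\ell=\lfloor c\log_\sigma m\rfloor$, has worst-case space usage $\Omega(N\log\sigma)$ bits (with the hidden constant depending on at most $c$).
   Context: Here $[0..\sigma)=\{0,\dots,\sigma-1\}$ and $\log$ without a base is base 2. For a sequence $W[1..m]$ of strings of length $\ell$, a string $X$ over $[0..\sigma)$ of length at most $\ell$, and $r\in\{1,\dots,m\}$, the prefix select query returns $\mathsf{prefix\text{-}select}_W(r,X)$: the $r$th smallest element of $\{j\in\{1,\dots,m\}:X\text{ is a prefix of }W[j]\}$ if this set has at least $r$ elements, and $\infty$ otherwise. A data structure supporting a query problem for a family of inputs (with parameters $c,\sigma,N$ fixed) assigns to each input a finite bit string; the answer to every query on an input is determined by the stored bit string and the query arguments only. The space used on an input is the length of its bit string, and the worst-case space usage is the maximum over all inputs in the family. Query time is irrelevant. *)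

theory Defs
  imports Complex_Main "HOL-Library.Extended_Nat" "HOL-Library.Sublist"
begin

text \<open>
  A string over the alphabet \<open>{0..<\<sigma>}\<close> is a list of naturals below \<open>\<sigma>\<close>.
  A sequence \<open>W[1..m]\<close> of strings is a list of length \<open>m\<close>; positions are counted from 1,
  so that \<open>W[j]\<close> is \<open>W ! (j - 1)\<close>.
\<close>

definition strings :: "nat \<Rightarrow> nat list set" where
  "strings \<sigma> = {X. set X \<subseteq> {0..<\<sigma>}}"

definition prefix_positions :: "'a list list \<Rightarrow> 'a list \<Rightarrow> nat set" where
  "prefix_positions W X = {j \<in> {1..length W}. prefix X (W ! (j - 1))}"

text \<open>Ranks \<open>r\<close> are counted from 1 as well.\<close>

definition prefix_select :: "'a list list \<Rightarrow> nat \<Rightarrow> 'a list \<Rightarrow> enat" where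
  "prefix_select W r X =
     (if r \<le> card (prefix_positions W X)
      then enat (sorted_list_of_set (prefix_positions W X) ! (r - 1))
      else \<infinity>)"

definition str_len :: "real \<Rightarrow> nat \<Rightarrow> nat \<Rightarrow> nat" where
  "str_len c \<sigma> m = nat \<lfloor>c * log (real \<sigma>) (real m)\<rfloor>"

definition admissible :: "real \<Rightarrow> nat \<Rightarrow> nat \<Rightarrow> nat \<Rightarrow> bool" where
  "admissible c \<sigma> N m \<longleftrightarrow> m \<ge> 2 \<and> str_len c \<sigma> m \<ge> 1 \<and> m * str_len c \<sigma> m \<le> N"

text \<open>The family of inputs; the number \<open>m\<close> of strings is the length of \<open>W\<close>.\<close>

definition inputs :: "real \<Rightarrow> nat \<Rightarrow> nat \<Rightarrow> nat list list set" where
  "inputs c \<sigma> N =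
     {W. admissible c \<sigma> N (length W) \<and>
         (\<forall>w \<in> set W. w \<in> strings \<sigma> \<and> length w = str_len c \<sigma> (length W))}"

text \<open>
  A data structure consists of \<open>enc\<close>, mapping an input to the stored bit string, and \<open>ans\<close>,
  which answers queries from the stored bit string and the query arguments alone.  In particular
  \<open>ans\<close> may depend on \<open>c\<close>, \<open>\<sigma>\<close>, \<open>N\<close> but has no access to \<open>m\<close> other than through the bit string.
\<close>

definition supports_prefix_select ::
  "real \<Rightarrow> nat \<Rightarrow> nat \<Rightarrow> (nat list list \<Rightarrow> bool list) \<Rightarrow>
   (bool list \<Rightarrow> nat \<Rightarrow> nat list \<Rightarrow> enat) \<Rightarrow> bool" where
  "supports_prefix_select c \<sigma> N enc ans \<longleftrightarrow>
     (\<forall>W \<in> inputs c \<sigma> N. \<forall>r \<in> {1..length W}. \<forall>X \<in> strings \<sigma>.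
        length X \<le> str_len c \<sigma> (length W) \<longrightarrow> ans (enc W) r X = prefix_select W r X)"

lemma finite_inputs: "finite (inputs c \<sigma> N)"
proof (rule finite_subset)
  let ?S = "{w. set w \<subseteq> {0..<\<sigma>} \<and> length w \<le> N}"
  show "inputs c \<sigma> N \<subseteq> {W. set W \<subseteq> ?S \<and> length W \<le> N}"
  proof
    fix W assume W: "W \<in> inputs c \<sigma> N"
    let ?l = "str_len c \<sigma> (length W)"
    have adm: "length W \<ge> 2" "?l \<ge> 1" "length W * ?l \<le> N"
      using W by (auto simp: inputs_def admissible_def)
    have "length W * 1 \<le> length W * ?l" "1 * ?l \<le> length W * ?l"
      using adm by (intro mult_le_mono; simp)+
    then have "length W \<le> N" "?l \<le> N" using adm(3) by linarith+
    then show "W \<in> {W. set W \<subseteq> ?S \<and> length W \<le> N}"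
      using W by (auto simp: inputs_def strings_def)
  qed
  show "finite {W. set W \<subseteq> ?S \<and> length W \<le> N}"
    by (intro finite_lists_length_le) simp
qed

lemma inputs_nonempty:
  assumes "admissible c \<sigma> N m" "\<sigma> \<ge> 2"
  shows "inputs c \<sigma> N \<noteq> {}"
proof -
  have "replicate m (replicate (str_len c \<sigma> m) 0) \<in> inputs c \<sigma> N"
    using assms by (auto simp: inputs_def strings_def)
  then show ?thesis by blast
qed

text \<open>
  The maximum is over a finite set, by \<open>finite_inputs\<close>, which is nonempty as soon as some
  admissible \<open>m\<close> exists.
\<close>

definition worst_case_space ::
  "real \<Rightarrow> nat \<Rightarrow> nat \<Rightarrow> (nat list list \<Rightarrow> bool list) \<Rightarrow> nat" where
  "worst_case_space c \<sigma> N enc = Max ((\<lambda>W. length (enc W)) ` inputs c \<sigma> N)"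

end

theory Submission
  imports Defs
begin

text \<open>
  Asking for all ranks with the query string \<open>W[j]\<close> reveals every position holding \<open>W[j]\<close>, so on
  inputs of a common length \<open>m\<close> the encoding is injective and, by counting, needs at least
  \<open>m \<ell> log \<sigma> - 1\<close> bits.  The largest admissible \<open>m\<close> satisfies \<open>4 m \<ell> > N\<close>, because passing from
  \<open>m\<close> to \<open>m + 1\<close> at most doubles both factors of \<open>m \<ell>\<close>.
\<close>

lemma finite_prefix_positions [simp]: "finite (prefix_positions W X)"
  by (simp add: prefix_positions_def)

lemma card_prefix_positions_le: "card (prefix_positions W X) \<le> length W"
proof -
  have "card (prefix_positions W X) \<le> card {1..length W}"
    by (rule card_mono) (auto simp: prefix_positions_def)
  then show ?thesis by simp
qed

text \<open>A set of positions in \<open>W\<close> has at most \<open>length W\<close> elements, so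
  the ranks up to \<open>length W\<close> enumerate all of it; any rank beyond its cardinality is
  answered by \<open>\<infinity>\<close>, which is no \<open>enat j\<close>.\<close>

lemma prefix_positions_eq_prefix_select:
  "prefix_positions W X = {j. \<exists>r \<in> {1..length W}. prefix_select W r X = enat j}"
proof (rule set_eqI)
  fix j
  let ?P = "prefix_positions W X"
  let ?xs = "sorted_list_of_set ?P"
  have "j \<in> ?P \<longleftrightarrow> (\<exists>i < card ?P. ?xs ! i = j)"
    by (metis finite_prefix_positions in_set_conv_nth length_sorted_list_of_set set_sorted_list_of_set)
  \<comment> \<open>List indices start at 0 and ranks at 1, hence \<open>r = Suc i\<close>.\<close>
  also have "\<dots> \<longleftrightarrow> (\<exists>r \<in> {1..card ?P}. ?xs ! (r - 1) = j)"
  proof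
    assume "\<exists>i < card ?P. ?xs ! i = j"
    then obtain i where "i < card ?P" "?xs ! i = j" by blast
    then show "\<exists>r \<in> {1..card ?P}. ?xs ! (r - 1) = j" by (intro bexI[of _ "Suc i"]) auto
  next
    assume "\<exists>r \<in> {1..card ?P}. ?xs ! (r - 1) = j"
    then obtain r where "r \<in> {1..card ?P}" "?xs ! (r - 1) = j" by blast
    then show "\<exists>i < card ?P. ?xs ! i = j" by (intro exI[of _ "r - 1"]) auto
  qed
  also have "\<dots> \<longleftrightarrow> (\<exists>r \<in> {1..length W}. prefix_select W r X = enat j)"
    using card_prefix_positions_le[of W X] by (fastforce simp: prefix_select_def split: if_splits)
  finally show "j \<in> ?P \<longleftrightarrow> j \<in> {j. \<exists>r \<in> {1..length W}. prefix_select W r X = enat j}"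
    by simp
qed

lemma enc_inj:
  assumes sup: "supports_prefix_select c \<sigma> N enc ans"
    and W: "W \<in> inputs c \<sigma> N" and W': "W' \<in> inputs c \<sigma> N"
    and len: "length W = length W'" and enc: "enc W = enc W'"
  shows "W = W'"
proof (rule nth_equalityI[OF len])
  fix i assume i: "i < length W"
  let ?X = "W ! i"
  have X: "?X \<in> strings \<sigma>" "length ?X = str_len c \<sigma> (length W)"
    using W i by (auto simp: inputs_def)
  have X': "length (W' ! i) = length ?X"
    using W' X(2) i len by (auto simp: inputs_def)
  \<comment> \<open>Equal lengths give both inputs the same range of ranks and the same
    \<open>str_len\<close>, so each query \<open>(r, ?X)\<close> is legal for both and is answered
    from the same bit string.\<close>
  have "prefix_select W r ?X = prefix_select W' r ?X" if "r \<in> {1..length W}" for r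
    proof -
    have "ans (enc V) r ?X = prefix_select V r ?X"
      if "V \<in> inputs c \<sigma> N" "length V = length W" for V
      using sup that \<open>r \<in> {1..length W}\<close> X by (simp add: supports_prefix_select_def)
    from this[OF W] this[OF W'] show ?thesis using len enc by simp
  qed
  then have "prefix_positions W ?X = prefix_positions W' ?X"
    using len by (simp add: prefix_positions_eq_prefix_select)
  moreover have "Suc i \<in> prefix_positions W ?X"
    using i by (simp add: prefix_positions_def)
  \<comment> \<open>Both strings have the same length, so the prefix relation at this position
    forces equality.\<close>
  ultimately have "prefix ?X (W' ! i)"
    by (simp add: prefix_positions_def)
  then show "?X = W' ! i"
    using X' by (auto simp: prefix_def)
qed

lemma card_inputs_length:
  assumes "admissible c \<sigma> N m"
  shows "card {W \<in> inputs c \<sigma> N. length W = m} = \<sigma> ^ (m * str_len c \<sigma> m)"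
proof -
  let ?A = "{w. set w \<subseteq> {0..<\<sigma>} \<and> length w = str_len c \<sigma> m}"
  have "{W \<in> inputs c \<sigma> N. length W = m} = {W. set W \<subseteq> ?A \<and> length W = m}"
    using assms by (auto simp: inputs_def strings_def)
  moreover have "finite ?A" by (rule finite_lists_length_eq) simp
  ultimately show ?thesis
    by (simp add: card_lists_length_eq power_mult[symmetric] mult.commute)
qed

text \<open>Codes may vary in length, so all bit strings of length at most \<open>L\<close> compete:
  there are \<open>2 ^ Suc L - 1\<close> of them. Hence the loss of one bit in the final
  bound.\<close>

lemma card_less_if_inj_on_bool_lists:
  fixes enc :: "'a \<Rightarrow> bool list"
  assumes "inj_on enc S" and "\<And>x. x \<in> S \<Longrightarrow> length (enc x) \<le> L"
  shows "card S < 2 ^ Suc L"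
proof -
  let ?B = "{xs :: bool list. set xs \<subseteq> UNIV \<and> length xs \<le> L}"
  have "card S = card (enc ` S)"
    using assms(1) by (simp add: card_image)
  also have "\<dots> \<le> card ?B"
    using assms(2) by (intro card_mono finite_lists_length_le) auto
  also have "\<dots> = (\<Sum>i\<le>L. 2 ^ i)"
    by (subst card_lists_length_le) simp_all
  also have "\<dots> < 2 ^ Suc L"
    by (induction L) auto
  finally show ?thesis .
qed

lemma worst_case_space_ge:
  assumes sup: "supports_prefix_select c \<sigma> N enc ans"
    and adm: "admissible c \<sigma> N m" and \<sigma>: "\<sigma> \<ge> 2"
  shows "real (m * str_len c \<sigma> m) * log 2 (real \<sigma>) < real (worst_case_space c \<sigma> N enc) + 1"
proof -
  let ?L = "worst_case_space c \<sigma> N enc" and ?n = "m * str_len c \<sigma> m"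
  let ?S = "{W \<in> inputs c \<sigma> N. length W = m}"
  have "inj_on enc ?S"
    by (rule inj_onI) (auto intro: enc_inj[OF sup])
  moreover have "length (enc W) \<le> ?L" if "W \<in> ?S" for W
    unfolding worst_case_space_def using that by (intro Max_ge) (auto simp: finite_inputs)
  ultimately have "\<sigma> ^ ?n < 2 ^ Suc ?L"
    using card_less_if_inj_on_bool_lists[of enc ?S ?L] card_inputs_length[OF adm] by simp
  then have "real \<sigma> ^ ?n < 2 ^ Suc ?L"
    using of_nat_less_iff[where 'a = real, of "\<sigma> ^ ?n" "2 ^ Suc ?L"] by simp
  then have "log 2 (real \<sigma> ^ ?n) < log 2 (2 ^ Suc ?L)"
    using \<sigma> by (subst log_less_cancel_iff) auto
  then show ?thesis
    using \<sigma> by (simp add: log_nat_power del: power_Suc)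
qed

lemma str_len_mono:
  assumes "0 < c" "\<sigma> \<ge> 2" "1 \<le> m" "m \<le> n"
  shows "str_len c \<sigma> m \<le> str_len c \<sigma> n"
  unfolding str_len_def using assms
  by (intro nat_mono floor_mono mult_left_mono) (auto simp: log_le_cancel_iff)

text \<open>Since \<open>m + 1 \<le> 2 * m \<le> \<sigma> * m\<close>, the logarithm to base
  \<open>\<sigma>\<close> grows by at most 1, and the factor \<open>c \<le> 1\<close> keeps the
  growth within 1.\<close>

lemma str_len_Suc_le:
  assumes "0 < c" "c \<le> 1" "\<sigma> \<ge> 2" "m \<ge> 1"
  shows "str_len c \<sigma> (Suc m) \<le> Suc (str_len c \<sigma> m)"
proof -
  have "real (Suc m) \<le> 2 * real m" using assms by simp
  also have "\<dots> \<le> real \<sigma> * real m"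
    using assms by (intro mult_right_mono) auto
  finally have "log \<sigma> (Suc m) \<le> log \<sigma> (real \<sigma> * real m)"
    using assms by (subst log_le_cancel_iff) auto
  also have "\<dots> = 1 + log \<sigma> m" using assms by (simp add: log_mult)
  finally have "c * log \<sigma> (Suc m) \<le> c * (1 + log \<sigma> m)"
    using assms by (intro mult_left_mono) auto
  also have "\<dots> \<le> c * log \<sigma> m + 1"
    using assms by (simp add: algebra_simps)
  finally have "\<lfloor>c * log \<sigma> (Suc m)\<rfloor> \<le> \<lfloor>c * log \<sigma> m\<rfloor> + 1"
    by linarith
  then show ?thesis unfolding str_len_def by linarith
qed

lemma admissible_large:
  assumes c: "0 < c" "c \<le> 1" and \<sigma>: "\<sigma> \<ge> 2" and ex: "\<exists>m. admissible c \<sigma> N m"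
  obtains m where "admissible c \<sigma> N m" "N < 4 * (m * str_len c \<sigma> m)"
proof -
  \<comment> \<open>Admissible lengths are bounded, so a greatest one exists.\<close>
  have bound: "m \<le> N" if "admissible c \<sigma> N m" for m
  proof -
    have "m * 1 \<le> m * str_len c \<sigma> m"
      using that by (intro mult_le_mono) (auto simp: admissible_def)
    also have "\<dots> \<le> N" using that by (simp add: admissible_def)
    finally show ?thesis by simp
  qed
  define m where "m = (GREATEST m. admissible c \<sigma> N m)"
  have adm: "admissible c \<sigma> N m"
    unfolding m_def using ex bound by (metis GreatestI_nat)
  have "\<not> admissible c \<sigma> N (Suc m)"
    using bound Greatest_le_nat[of "admissible c \<sigma> N" "Suc m" N] by (auto simp: m_def)
  moreover have m: "m \<ge> 2" "str_len c \<sigma> m \<ge> 1"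
    using adm by (auto simp: admissible_def)
  \<comment> \<open>Monotonicity keeps the string length for \<open>Suc m\<close> at least 1, so
    \<open>Suc m\<close> can fail to be admissible only by exceeding the size bound
    \<open>N\<close>.\<close>
  moreover have "str_len c \<sigma> m \<le> str_len c \<sigma> (Suc m)"
    using c \<sigma> m by (intro str_len_mono) auto
  ultimately have "N < Suc m * str_len c \<sigma> (Suc m)"
    by (auto simp: admissible_def)
  also have "\<dots> \<le> (2 * m) * (2 * str_len c \<sigma> m)"
    using str_len_Suc_le[OF c \<sigma>, of m] m by (intro mult_le_mono) auto
  finally show ?thesis
    using adm by (intro that) auto
qed

theorem corollary5p15:
  fixes c :: real
  assumes "0 < c" and "c \<le> 1"
  shows "\<exists>K::real. K > 0 \<and>
    (\<forall>\<sigma> N :: nat. \<sigma> \<ge> 2 \<longrightarrow> N \<ge> 2 \<longrightarrow> (\<exists>m. admissible c \<sigma> N m) \<longrightarrow>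
      (\<forall>enc ans. supports_prefix_select c \<sigma> N enc ans \<longrightarrow>
         real (worst_case_space c \<sigma> N enc) \<ge> K * (real N * log 2 (real \<sigma>))))"
proof (intro exI[of _ "1/8"] conjI allI impI)
  fix \<sigma> N :: nat and enc ans
  assume \<sigma>: "\<sigma> \<ge> 2" and ex: "\<exists>m. admissible c \<sigma> N m"
    and sup: "supports_prefix_select c \<sigma> N enc ans"
  obtain m where adm: "admissible c \<sigma> N m" and N: "N < 4 * (m * str_len c \<sigma> m)"
    using admissible_large[OF assms \<sigma> ex] .
  let ?n = "m * str_len c \<sigma> m"
  have log: "log 2 \<sigma> \<ge> 1" using \<sigma> by simp
  \<comment> \<open>As \<open>?n * log 2 \<sigma>\<close> is at least 2, subtracting 1 from it
    leaves at least half. This factor 2, together with the factor 4 from the choice of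
    \<open>m\<close>, gives the constant 1/8, which does not depend on \<open>c\<close>.\<close>
  have "2 * 1 \<le> ?n"
    using adm by (intro mult_le_mono) (auto simp: admissible_def)
  then have "2 * 1 \<le> real ?n * log 2 \<sigma>"
    using log by (intro mult_mono) linarith+
  moreover have "real N * log 2 \<sigma> \<le> (4 * real ?n) * log 2 \<sigma>"
    using N log by (intro mult_right_mono) linarith+
  ultimately show "1 / 8 * (real N * log 2 \<sigma>) \<le> worst_case_space c \<sigma> N enc"
    using worst_case_space_ge[OF sup adm \<sigma>] by linarith
qed simp

end
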